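(* Let $\mathcal{H}$ be a Heyting algebra (in the sense of the context), let $(E,d)$ be a metric space over $\mathcal{H}$ and let $X\subseteq E$. Then $(E,d)$ is (isomorphic, via an isomorphism which is the identity on $X$, to) the injective envelope of $(X,d_{\restriction X})$ if and only if for every metric space $(E',d')$ over $\mathcal{H}$, every $X'\subseteq E'$ and every isometry $f$ from $(X,d_{\restriction X})$ onto $(X',d'_{\restriction X'})$: (i) every non-expansive map $\overline f:(E,d)\to(E',d')$, if any, which extends $f$ is an isometric embedding of $(E,d)$ into $(E',d')$; (ii) the isometry $f^{-1}$ extends to a non-expansive map from $(E',d')$ into $(E,d)$.
   Context: A Heyting algebra here is a complete lattice $\mathcal{H}$ with a (not necessarily commutative) monoid operation $\cdot$ whose neutral element $1$ is the least element of $\mathcal{H}$, and an involution $r\mapsto\overline r$ which is order-preserving and reverses the operation ($\overline{p\cdot q}=\overline q\cdot\overline p$), such that $\bigwedge_{\alpha\in I}(p_\alpha\cdot q)=(\bigwedge_{\alpha\in I}p_\alpha)\cdot q$ for all families $(p_\alpha)_{\alpha\in I}$ and all $q$ in $\mathcal{H}$. A metric space over $\mathcal{H}$ is a set $E$ with a map $d:E\times E\to\mathcal{H}$ such that for all $x,y,z$: $d(x,y)=1\iff x=y$; $d(x,y)\le d(x,z)\cdot d(z,y)$; $d(x,y)=\overline{d(y,x)}$. A map $f:(E,d)\to(E',d')$ is non-expansive (a contraction) if $d'(f(x),f(y))\le d(x,y)$ for all $x,y$, and an isometry (isometric embedding) if equality always holds. Spaces are isomorphic if there is a surjective isometry between them.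 A space $E$ is injective if for all spaces $E',E''$, every non-expansive $f:E'\to E$ and every isometry $g:E'\to E''$ there is a non-expansive $h:E''\to E$ with $h\circ g=f$. A non-expansive map $f:E\to E'$ is essential if for every non-expansive $g:E'\to E''$, $g\circ f$ is an isometry if and only if $g$ is an isometry. An injective envelope of $E$ is an injective space $E'$ together with an essential map $E\to E'$ (necessarily an isometry, used to view $E$ as a subspace of $E'$). Every metric space over $\mathcal{H}$ has an injective envelope, unique up to an isomorphism which is the identity on $E$. *)

theory Defs
  imports "HOL-Library.FuncSet"
begin

text \<open>
  The operation need not be commutative. The distributive law for families is stated for sets;
  \<open>INF_mult_right\<close> below is the version for families over an arbitrary (possibly empty) index set.
\<close>

class heyting_monoid = complete_lattice + monoid_mult +
  fixes invol :: "'a \<Rightarrow> 'a"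
  assumes one_least: "1 \<le> p"
    and invol_invol: "invol (invol p) = p"
    and invol_mono: "p \<le> q \<Longrightarrow> invol p \<le> invol q"
    and invol_mult: "invol (p * q) = invol q * invol p"
    and Inf_mult_right: "Inf P * q = (INF p\<in>P. p * q)"

lemma INF_mult_right:
  fixes p :: "'i \<Rightarrow> 'h::heyting_monoid"
  shows "(INF i\<in>I. p i) * q = (INF i\<in>I. p i * q)"
  by (simp add: Inf_mult_right image_image)

text \<open>
  Spaces are carrier sets with a distance function whose values off the carrier are irrelevant;
  a subspace is therefore given by a subset of the carrier and the same distance function.
\<close>

definition metric_over :: "'a set \<Rightarrow> ('a \<Rightarrow> 'a \<Rightarrow> 'h::heyting_monoid) \<Rightarrow> bool" where
  "metric_over E d \<longleftrightarrow>
     (\<forall>x\<in>E. \<forall>y\<in>E. d x y = 1 \<longleftrightarrow> x = y) \<and>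
     (\<forall>x\<in>E. \<forall>y\<in>E. \<forall>z\<in>E. d x y \<le> d x z * d z y) \<and>
     (\<forall>x\<in>E. \<forall>y\<in>E. d x y = invol (d y x))"

definition nonexpansive ::
  "'a set \<Rightarrow> ('a \<Rightarrow> 'a \<Rightarrow> 'h::heyting_monoid) \<Rightarrow> 'b set \<Rightarrow> ('b \<Rightarrow> 'b \<Rightarrow> 'h) \<Rightarrow> ('a \<Rightarrow> 'b) \<Rightarrow> bool" where
  "nonexpansive E d E' d' f \<longleftrightarrow> f \<in> E \<rightarrow> E' \<and> (\<forall>x\<in>E. \<forall>y\<in>E. d' (f x) (f y) \<le> d x y)"

definition isometry ::
  "'a set \<Rightarrow> ('a \<Rightarrow> 'a \<Rightarrow> 'h::heyting_monoid) \<Rightarrow> 'b set \<Rightarrow> ('b \<Rightarrow> 'b \<Rightarrow> 'h) \<Rightarrow> ('a \<Rightarrow> 'b) \<Rightarrow> bool" where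
  "isometry E d E' d' f \<longleftrightarrow> f \<in> E \<rightarrow> E' \<and> (\<forall>x\<in>E. \<forall>y\<in>E. d' (f x) (f y) = d x y)"

definition isomorphism ::
  "'a set \<Rightarrow> ('a \<Rightarrow> 'a \<Rightarrow> 'h::heyting_monoid) \<Rightarrow> 'b set \<Rightarrow> ('b \<Rightarrow> 'b \<Rightarrow> 'h) \<Rightarrow> ('a \<Rightarrow> 'b) \<Rightarrow> bool" where
  "isomorphism E d E' d' f \<longleftrightarrow> isometry E d E' d' f \<and> f ` E = E'"

text \<open>
  Injectivity and essentiality quantify over all metric spaces. A formula of HOL cannot quantify
  over types, so the test spaces range over all metric spaces whose carrier is a set of elements
  of a universe type \<open>'u\<close>, passed as an argument. For spaces on subsets of \<open>'a\<close> the universe must at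
  least have room for one-point extensions, i.e. contain a copy of \<open>'a option\<close>; over a smaller one,
  such as \<open>unit\<close>, the test spaces say too little.
\<close>

definition injective_space ::
  "'u itself \<Rightarrow> 'a set \<Rightarrow> ('a \<Rightarrow> 'a \<Rightarrow> 'h::heyting_monoid) \<Rightarrow> bool" where
  "injective_space U E d \<longleftrightarrow> metric_over E d \<and>
     (\<forall>(E' :: 'u set) d' (E'' :: 'u set) d'' f g.
        metric_over E' d' \<and> metric_over E'' d'' \<and>
        nonexpansive E' d' E d f \<and> isometry E' d' E'' d'' g \<longrightarrow>
        (\<exists>h. nonexpansive E'' d'' E d h \<and> (\<forall>x\<in>E'. h (g x) = f x)))"

definition essential_map ::
  "'u itself \<Rightarrow> 'a set \<Rightarrow> ('a \<Rightarrow> 'a \<Rightarrow> 'h::heyting_monoid) \<Rightarrow>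
     'b set \<Rightarrow> ('b \<Rightarrow> 'b \<Rightarrow> 'h) \<Rightarrow> ('a \<Rightarrow> 'b) \<Rightarrow> bool" where
  "essential_map U E d E' d' f \<longleftrightarrow> nonexpansive E d E' d' f \<and>
     (\<forall>(E'' :: 'u set) d'' g.
        metric_over E'' d'' \<and> nonexpansive E' d' E'' d'' g \<longrightarrow>
        (isometry E d E'' d'' (g \<circ> f) \<longleftrightarrow> isometry E' d' E'' d'' g))"

definition injective_envelope ::
  "'u itself \<Rightarrow> 'a set \<Rightarrow> ('a \<Rightarrow> 'a \<Rightarrow> 'h::heyting_monoid) \<Rightarrow>
     'b set \<Rightarrow> ('b \<Rightarrow> 'b \<Rightarrow> 'h) \<Rightarrow> ('a \<Rightarrow> 'b) \<Rightarrow> bool" where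
  "injective_envelope U X d N dN j \<longleftrightarrow> injective_space U N dN \<and> essential_map U X d N dN j"

text \<open>
  \<open>X\<close> is viewed as a subspace of its envelope \<open>N\<close> through the essential map \<open>j\<close>, so an isomorphism
  from \<open>E\<close> onto \<open>N\<close> is the identity on \<open>X\<close> if it agrees with \<open>j\<close> there. The envelope is unique up
  to such an isomorphism, whence ``isomorphic to the envelope'' is ``isomorphic to some envelope''.
\<close>

definition is_envelope_of_subspace ::
  "'u itself \<Rightarrow> 'a set \<Rightarrow> ('a \<Rightarrow> 'a \<Rightarrow> 'h::heyting_monoid) \<Rightarrow> 'a set \<Rightarrow> bool" where
  "is_envelope_of_subspace U E d X \<longleftrightarrow>
     (\<exists>(N :: 'u set) dN j \<phi>. injective_envelope U X d N dN j \<and>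
        isomorphism E d N dN \<phi> \<and> (\<forall>x\<in>X. \<phi> x = j x))"

end

theory Submission
  imports Defs
begin

text \<open>
  Call \<open>p\<close> a form on \<open>E\<close> if it behaves like the distances from an additional point. By Zorn's lemma
  \<open>E\<close> is injective as soon as every form dominates the distances from some point of \<open>E\<close>, and this
  only needs retractions of the one-point extensions of \<open>E\<close>; hence injectivity does not depend on
  the universe of the test spaces. If \<open>X \<rightarrow> E\<close> is essential, then the points of \<open>E\<close> are determined
  by their distances to \<open>X\<close>, because otherwise two of them could be glued without changing the
  distances on \<open>X\<close>. Consequently \<open>E\<close> is rigid over \<open>X\<close>: a non-expansive self-map fixing \<open>X\<close> is an
  isometry, preserves the distances to \<open>X\<close>, and so is the identity. Conversely, (i) is essentiality,
  and (ii) for a one-point extension of \<open>E\<close> gives a map to \<open>E\<close> that is a retraction by rigidity.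
\<close>

section \<open>Arithmetic of the value monoid\<close>

lemma invol_le_iff: "invol p \<le> invol q \<longleftrightarrow> p \<le> (q::'h::heyting_monoid)"
  using invol_mono invol_invol by metis

lemma invol_one [simp]: "invol (1::'h::heyting_monoid) = 1"
  by (metis antisym one_least invol_mono invol_invol)

text \<open>An order-preserving involution is its own inverse, hence an order automorphism, and so
  commutes with infima.\<close>

lemma invol_INF:
  fixes p :: "'i \<Rightarrow> 'h::heyting_monoid"
  shows "invol (INF i\<in>I. p i) = (INF i\<in>I. invol (p i))"
proof (rule antisym)
  show "invol (INF i\<in>I. p i) \<le> (INF i\<in>I. invol (p i))"
    by (intro INF_greatest invol_mono INF_lower)
  have "invol (INF i\<in>I. invol (p i)) \<le> (INF i\<in>I. p i)"
    by (rule INF_greatest) (metis INF_lower invol_mono invol_invol)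
  then show "(INF i\<in>I. invol (p i)) \<le> invol (INF i\<in>I. p i)"
    by (metis invol_mono invol_invol)
qed

text \<open>The involution reverses products and preserves infima, so it carries right
  distributivity to left distributivity.\<close>

lemma INF_mult_left:
  fixes p :: "'i \<Rightarrow> 'h::heyting_monoid"
  shows "q * (INF i\<in>I. p i) = (INF i\<in>I. q * p i)"
proof -
  have "invol (q * (INF i\<in>I. p i)) = invol (INF i\<in>I. q * p i)"
    by (simp add: invol_mult invol_INF INF_mult_right)
  then show ?thesis by (metis invol_invol)
qed

lemma inf_mult_right: "inf p q * r = inf (p * r) (q * (r::'h::heyting_monoid))"
  using Inf_mult_right[of "{p, q}" r] by simp

lemma inf_mult_left: "r * inf p q = inf (r * p) (r * (q::'h::heyting_monoid))"
  using INF_mult_left[of r "\<lambda>x. x" "{p, q}"] by simp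

lemma invol_inf: "invol (inf p q) = inf (invol p) (invol (q::'h::heyting_monoid))"
  using invol_INF[of "\<lambda>x. x" "{p, q}"] by simp

text \<open>Monotonicity is not an axiom: it comes from distributivity over binary meets, reading
  \<open>p \<le> p'\<close> as \<open>p = inf p p'\<close>.\<close>

lemma heyting_mult_mono:
  fixes p :: "'h::heyting_monoid"
  assumes "p \<le> p'" "q \<le> q'"
  shows "p * q \<le> p' * q'"
proof -
  have "p * q \<le> p' * q"
    using inf_mult_right[of p p' q] assms(1) by (simp add: le_iff_inf)
  also have "\<dots> \<le> p' * q'"
    using inf_mult_left[of p' q q'] assms(2) by (simp add: le_iff_inf)
  finally show ?thesis .
qed

lemma le_mult_left: "q \<le> p * (q::'h::heyting_monoid)"
  using heyting_mult_mono[OF one_least order.refl, of q p] by simp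

lemma le_mult_right: "p \<le> p * (q::'h::heyting_monoid)"
  using heyting_mult_mono[OF order.refl one_least, of p q] by simp

lemma le_one_iff: "p \<le> 1 \<longleftrightarrow> p = (1::'h::heyting_monoid)"
  using one_least antisym by blast

section \<open>Metric spaces and maps\<close>

lemma metric_overD:
  assumes "metric_over E d"
  shows metric_self: "x \<in> E \<Longrightarrow> d x x = 1"
    and metric_eq: "x \<in> E \<Longrightarrow> y \<in> E \<Longrightarrow> d x y = 1 \<Longrightarrow> x = y"
    and metric_triangle: "x \<in> E \<Longrightarrow> y \<in> E \<Longrightarrow> z \<in> E \<Longrightarrow> d x y \<le> d x z * d z y"
    and metric_invol: "x \<in> E \<Longrightarrow> y \<in> E \<Longrightarrow> invol (d x y) = d y x"
  using assms unfolding metric_over_def by (blast, blast, blast, metis)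

lemma metric_over_subset: "metric_over E d \<Longrightarrow> A \<subseteq> E \<Longrightarrow> metric_over A d"
  unfolding metric_over_def by (meson subsetD)

lemma metric_over_pullback:
  assumes "metric_over E d" "inj_on k A" "k ` A \<subseteq> E"
  shows "metric_over A (\<lambda>x y. d (k x) (k y))"
  unfolding metric_over_def
proof (intro conjI ballI)
  have k: "k x \<in> E" if "x \<in> A" for x using assms(3) that by blast
  fix x y assume xy: "x \<in> A" "y \<in> A"
  show "d (k x) (k y) = 1 \<longleftrightarrow> x = y"
    using metric_eq[OF assms(1) k k] metric_self[OF assms(1) k] inj_onD[OF assms(2)] xy by metis
  show "d (k x) (k y) = invol (d (k y) (k x))"
    using metric_invol[OF assms(1) k k] xy by simp
  fix z assume "z \<in> A"
  then show "d (k x) (k y) \<le> d (k x) (k z) * d (k z) (k y)"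
    using metric_triangle[OF assms(1) k k k] xy by blast
qed

lemma isometry_inj_on:
  assumes "metric_over E d" "metric_over E' d'" "isometry E d E' d' f"
  shows "inj_on f E"
proof (rule inj_onI)
  fix x y assume xy: "x \<in> E" "y \<in> E" "f x = f y"
  then have "d x y = d' (f x) (f x)" using assms(3) unfolding isometry_def by metis
  also have "\<dots> = 1"
  proof (rule metric_self[OF assms(2)])
    show "f x \<in> E'" using assms(3) xy(1) by (auto simp: isometry_def)
  qed
  finally show "x = y" by (rule metric_eq[OF assms(1) xy(1,2)])
qed

lemma isometry_nonexpansive: "isometry E d E' d' f \<Longrightarrow> nonexpansive E d E' d' f"
  unfolding isometry_def nonexpansive_def by auto

lemma nonexpansive_comp:
  assumes "nonexpansive A d B e f" "nonexpansive B e C c g"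
  shows "nonexpansive A d C c (g \<circ> f)"
  unfolding nonexpansive_def
proof (intro conjI ballI)
  have f: "f x \<in> B" if "x \<in> A" for x using assms(1) that by (auto simp: nonexpansive_def)
  then show "g \<circ> f \<in> A \<rightarrow> C" using assms(2) by (auto simp: nonexpansive_def)
  fix x y assume xy: "x \<in> A" "y \<in> A"
  then have "c (g (f x)) (g (f y)) \<le> e (f x) (f y)"
    using assms(2) f by (simp add: nonexpansive_def)
  also have "\<dots> \<le> d x y" using assms(1) xy by (simp add: nonexpansive_def)
  finally show "c ((g \<circ> f) x) ((g \<circ> f) y) \<le> d x y" by simp
qed

lemma isometry_comp:
  assumes "isometry A d B e f" "isometry B e C c g"
  shows "isometry A d C c (g \<circ> f)"
  using assms unfolding isometry_def by (auto simp: Pi_iff)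

lemma isomorphism_inv:
  assumes "metric_over E d" "metric_over E' d'" "isomorphism E d E' d' f"
  shows "isomorphism E' d' E d (inv_into E f)"
proof -
  have f: "isometry E d E' d' f" "f ` E = E'" using assms(3) by (auto simp: isomorphism_def)
  have inj: "inj_on f E" using isometry_inj_on assms f by blast
  have "isometry E' d' E d (inv_into E f)"
    unfolding isometry_def
  proof (intro conjI ballI)
    have pre: "inv_into E f x \<in> E" "f (inv_into E f x) = x" if "x \<in> E'" for x
      using that f(2) by (auto intro: inv_into_into f_inv_into_f)
    then show "inv_into E f \<in> E' \<rightarrow> E" by simp
    fix x y assume xy: "x \<in> E'" "y \<in> E'"
    then have "d' (f (inv_into E f x)) (f (inv_into E f y)) = d (inv_into E f x) (inv_into E f y)"
      using f(1) pre(1) unfolding isometry_def by blast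
    then show "d (inv_into E f x) (inv_into E f y) = d' x y"
      using pre(2) xy by simp
  qed
  then show ?thesis
    unfolding isomorphism_def using inv_into_image_cancel[OF inj order.refl] f(2) by simp
qed

text \<open>This moves a space into another type, so that a copy of it can serve as a test space of
  the given universe.\<close>

lemma metric_transport:
  assumes "metric_over E d" "inj_on i E"
  defines "D \<equiv> \<lambda>x y. d (inv_into E i x) (inv_into E i y)"
  shows "metric_over (i ` E) D" "isomorphism E d (i ` E) D i"
proof -
  have "metric_over (i ` E) (\<lambda>x y. d (inv_into E i x) (inv_into E i y))"
    by (rule metric_over_pullback[OF assms(1) inj_on_inv_into]) (auto intro: inv_into_into)
  then show "metric_over (i ` E) D" by (simp add: D_def)
  show "isomorphism E d (i ` E) D i"
    using assms(2) by (auto simp: isomorphism_def isometry_def D_def)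
qed

text \<open>The quotient is formed by chosen representatives inside \<open>E\<close> instead of
  equivalence classes, so both the type and the function \<open>\<rho>\<close> stay the
  same.\<close>

lemma pseudometric_quotient:
  fixes \<rho> :: "'a \<Rightarrow> 'a \<Rightarrow> 'h::heyting_monoid"
  assumes self: "\<And>x. x \<in> E \<Longrightarrow> \<rho> x x = 1"
    and tri: "\<And>x y z. x \<in> E \<Longrightarrow> y \<in> E \<Longrightarrow> z \<in> E \<Longrightarrow> \<rho> x y \<le> \<rho> x z * \<rho> z y"
    and sym: "\<And>x y. x \<in> E \<Longrightarrow> y \<in> E \<Longrightarrow> \<rho> x y = invol (\<rho> y x)"
  obtains q where "q \<in> E \<rightarrow> E" "metric_over (q ` E) \<rho>"
    "\<And>x y. x \<in> E \<Longrightarrow> y \<in> E \<Longrightarrow> \<rho> (q x) (q y) = \<rho> x y"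
proof -
  define q where "q x = (SOME y. y \<in> E \<and> \<rho> x y = 1)" for x
  have q: "q x \<in> E" "\<rho> x (q x) = 1" if "x \<in> E" for x
    using someI[of "\<lambda>y. y \<in> E \<and> \<rho> x y = 1" x] self that unfolding q_def by auto
  have cong: "\<rho> x z \<le> \<rho> y z" if "x \<in> E" "y \<in> E" "z \<in> E" "\<rho> x y = 1" for x y z
    using tri[of x z y] that by simp
  have cong_eq: "\<rho> x z = \<rho> y z" if "x \<in> E" "y \<in> E" "z \<in> E" "\<rho> x y = 1" for x y z
    using cong[of x y z] cong[of y x z] sym[of y x] that by (simp add: order.antisym)
  have left: "\<rho> (q x) z = \<rho> x z" if "x \<in> E" "z \<in> E" for x z
    using cong_eq[of x "q x" z] q[of x] that by simp
  have right: "\<rho> z (q x) = \<rho> z x" if "x \<in> E" "z \<in> E" for x z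
    using left sym that q by metis
  have same: "q x = q y" if "x \<in> E" "y \<in> E" "\<rho> x y = 1" for x y
  proof -
    \<comment> \<open>Points at distance 1 have the same candidates for a representative, and
      \<open>SOME\<close> depends only on the set of candidates.\<close>
    have "z \<in> E \<and> \<rho> x z = 1 \<longleftrightarrow> z \<in> E \<and> \<rho> y z = 1" for z
      using cong_eq[of x y z] that by auto
    then show ?thesis unfolding q_def by simp
  qed
  show thesis
  proof
    show "q \<in> E \<rightarrow> E" using q by blast
    show eq: "\<rho> (q x) (q y) = \<rho> x y" if "x \<in> E" "y \<in> E" for x y
      using left right q that by simp
    show "metric_over (q ` E) \<rho>"
      unfolding metric_over_def
    proof (intro conjI ballI)
      fix x y assume "x \<in> q ` E" "y \<in> q ` E"
      then obtain u v where uv: "u \<in> E" "v \<in> E" "x = q u" "y = q v" by blast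
      show "\<rho> x y = 1 \<longleftrightarrow> x = y"
        using same[of u v] eq[of u v] self[of "q u"] q(1)[of u] uv by auto
      have xy: "x \<in> E" "y \<in> E" using q(1) uv by simp_all
      then show "\<rho> x y = invol (\<rho> y x)" by (rule sym)
      fix z assume "z \<in> q ` E"
      then have "z \<in> E" using q(1) by auto
      then show "\<rho> x y \<le> \<rho> x z * \<rho> z y" by (rule tri[OF xy])
    qed
  qed
qed

section \<open>Forms and one-point extensions\<close>

text \<open>Read \<open>p x\<close> as the distance from a new point to \<open>x\<close>, and
  \<open>invol (p x)\<close> as the distance back. The value 1 is allowed; the new point then falls
  onto an old one.\<close>

definition distance_form :: "'a set \<Rightarrow> ('a \<Rightarrow> 'a \<Rightarrow> 'h::heyting_monoid) \<Rightarrow> ('a \<Rightarrow> 'h) \<Rightarrow> bool" where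
  "distance_form E d p \<longleftrightarrow>
     (\<forall>x\<in>E. \<forall>y\<in>E. p y \<le> p x * d x y \<and> d x y \<le> invol (p x) * p y)"

text \<open>Sending the new point to \<open>c\<close> and fixing \<open>E\<close> is then
  non-expansive; the reverse distances follow by the involution. This expresses injectivity without
  any universe of test spaces.\<close>

definition forms_dominate :: "'a set \<Rightarrow> ('a \<Rightarrow> 'a \<Rightarrow> 'h::heyting_monoid) \<Rightarrow> bool" where
  "forms_dominate E d \<longleftrightarrow>
     (\<forall>p. distance_form E d p \<longrightarrow> (\<exists>c\<in>E. \<forall>x\<in>E. d c x \<le> p x))"

fun one_point_dist ::
  "('a \<Rightarrow> 'a \<Rightarrow> 'h::heyting_monoid) \<Rightarrow> ('a \<Rightarrow> 'h) \<Rightarrow> 'a option \<Rightarrow> 'a option \<Rightarrow> 'h" where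
  "one_point_dist d p (Some x) (Some y) = d x y"
| "one_point_dist d p None (Some y) = p y"
| "one_point_dist d p (Some x) None = invol (p x)"
| "one_point_dist d p None None = 1"

lemma metric_one_point:
  assumes E: "metric_over E d" and p: "distance_form E d p" and ne: "\<And>x. x \<in> E \<Longrightarrow> p x \<noteq> 1"
  shows "metric_over (insert None (Some ` E)) (one_point_dist d p)"
proof -
  have inv_ne: "invol (p x) \<noteq> 1" if "x \<in> E" for x
    using ne[OF that] by (metis invol_invol invol_one)
  \<comment> \<open>This is the triangle inequality for paths ending at the new point, the involute
    of the one for paths starting there.\<close>
  have inv_tri: "invol (p x) \<le> d x y * invol (p y)" if "x \<in> E" "y \<in> E" for x y
  proof -
    have "p x \<le> p y * d y x" using p that by (auto simp: distance_form_def)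
    then have "invol (p x) \<le> invol (p y * d y x)" by (rule invol_mono)
    then show ?thesis using metric_invol[OF E] that by (simp add: invol_mult)
  qed
  show ?thesis
    unfolding metric_over_def
  proof (intro conjI ballI)
    fix s t assume s: "s \<in> insert None (Some ` E)" and t: "t \<in> insert None (Some ` E)"
    show "one_point_dist d p s t = 1 \<longleftrightarrow> s = t"
      using s t ne inv_ne metric_self[OF E] metric_eq[OF E] by auto
    show "one_point_dist d p s t = invol (one_point_dist d p t s)"
      using s t metric_invol[OF E] by (auto simp: invol_invol)
    fix r assume "r \<in> insert None (Some ` E)"
    then show "one_point_dist d p s t \<le> one_point_dist d p s r * one_point_dist d p r t"
      using s t p inv_tri metric_triangle[OF E] by (auto simp: distance_form_def one_least)
  qed
qed

text \<open>A form without value 1 yields a one-point extension, which \<open>\<iota>\<close> copies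
  into the universe; a retraction sends the new point to the required \<open>c\<close>.\<close>

lemma forms_dominateI:
  fixes d :: "'a \<Rightarrow> 'a \<Rightarrow> 'h::heyting_monoid" and \<iota> :: "'a option \<Rightarrow> 'u"
  assumes E: "metric_over E d" and inj: "inj \<iota>"
    and retract: "\<And>A D. metric_over A D \<Longrightarrow> isometry E d A D (\<iota> \<circ> Some) \<Longrightarrow>
      \<exists>r. nonexpansive A D E d r \<and> (\<forall>x\<in>E. r (\<iota> (Some x)) = x)"
  shows "forms_dominate E d"
  unfolding forms_dominate_def
proof (intro allI impI)
  fix p assume p: "distance_form E d p"
  show "\<exists>c\<in>E. \<forall>x\<in>E. d c x \<le> p x"
  proof (cases "\<exists>c\<in>E. p c = 1")
    \<comment> \<open>A distinct new point would violate the metric axioms here, but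
      \<open>c\<close> itself works: \<open>d c x \<le> invol (p c) * p x = p x\<close>.\<close>
    case True
    then obtain c where c: "c \<in> E" "p c = 1" by blast
    then have "d c x \<le> p x" if "x \<in> E" for x
      using p that unfolding distance_form_def by (metis invol_one mult_1_left)
    then show ?thesis using c by blast
  next
    case False
    define P where "P = insert None (Some ` E)"
    have P: "metric_over P (one_point_dist d p)"
      unfolding P_def by (rule metric_one_point[OF E p]) (use False in blast)
    define D where "D s t = one_point_dist d p (inv_into P \<iota> s) (inv_into P \<iota> t)" for s t
    have inj_P: "inj_on \<iota> P" using inj by (rule inj_on_subset) simp
    have D: "metric_over (\<iota> ` P) D"
      unfolding D_def by (rule metric_transport(1)[OF P inj_P])
    have D_eq: "D (\<iota> s) (\<iota> t) = one_point_dist d p s t" if "s \<in> P" "t \<in> P" for s t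
      using that inj_P by (simp add: D_def)
    have "isometry E d (\<iota> ` P) D (\<iota> \<circ> Some)"
      by (auto simp: isometry_def D_eq P_def)
    then obtain r where r: "nonexpansive (\<iota> ` P) D E d r" "\<And>x. x \<in> E \<Longrightarrow> r (\<iota> (Some x)) = x"
      using retract D by blast
    have "None \<in> P" by (simp add: P_def)
    then have "r (\<iota> None) \<in> E" using r(1) by (auto simp: nonexpansive_def)
    moreover have "d (r (\<iota> None)) x \<le> p x" if "x \<in> E" for x
    proof -
      have "Some x \<in> P" using that by (simp add: P_def)
      then have "d (r (\<iota> None)) (r (\<iota> (Some x))) \<le> D (\<iota> None) (\<iota> (Some x))"
        using r(1) \<open>None \<in> P\<close> by (auto simp: nonexpansive_def)
      then show ?thesis using D_eq \<open>Some x \<in> P\<close> \<open>None \<in> P\<close> r(2) that by simp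
    qed
    ultimately show ?thesis by blast
  qed
qed

text \<open>Zorn's lemma gives a maximal partial extension; a point outside its domain would define
  a form on \<open>E\<close>, and a point dominated by that form would be an admissible value
  there.\<close>

lemma forms_dominate_extend:
  fixes d :: "'a \<Rightarrow> 'a \<Rightarrow> 'h::heyting_monoid" and d' :: "'b \<Rightarrow> 'b \<Rightarrow> 'h"
  assumes E: "metric_over E d" and dom: "forms_dominate E d"
    and E': "metric_over E' d'" and Y: "Y \<subseteq> E'" and h: "nonexpansive Y d' E d h"
  obtains h' where "nonexpansive E' d' E d h'" "\<And>y. y \<in> Y \<Longrightarrow> h' y = h y"
proof -
  text \<open>Partial non-expansive maps are handled as graphs; single-valuedness is automatic.\<close>
  define contr where
    "contr G \<longleftrightarrow> (\<forall>y u y' u'. (y, u) \<in> G \<and> (y', u') \<in> G \<longrightarrow> d u u' \<le> d' y y')" for G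
  define G0 where "G0 = (\<lambda>y. (y, h y)) ` Y"
  define \<A> where "\<A> = {G. G0 \<subseteq> G \<and> G \<subseteq> E' \<times> E \<and> contr G}"
  have "G0 \<in> \<A>"
    using Y h by (auto simp: \<A>_def G0_def contr_def nonexpansive_def)
  have "\<exists>M\<in>\<A>. \<forall>G\<in>\<A>. M \<subseteq> G \<longrightarrow> G = M"
  proof (rule subset_Zorn_nonempty)
    show "\<A> \<noteq> {}" using \<open>G0 \<in> \<A>\<close> by blast
    fix C assume C: "C \<noteq> {}" "subset.chain \<A> C"
    have sub: "C \<subseteq> \<A>" and lin: "\<And>G H. G \<in> C \<Longrightarrow> H \<in> C \<Longrightarrow> G \<subseteq> H \<or> H \<subseteq> G"
      using C(2) by (auto simp: subset_chain_def)
    have "contr (\<Union>C)"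
      unfolding contr_def
    proof (intro allI impI, elim conjE UnionE)
      fix y u y' u' G H assume *: "(y, u) \<in> G" "G \<in> C" "(y', u') \<in> H" "H \<in> C"
      then obtain K where "K \<in> C" "(y, u) \<in> K" "(y', u') \<in> K" using lin by blast
      then show "d u u' \<le> d' y y'" using sub unfolding \<A>_def contr_def by blast
    qed
    then show "\<Union>C \<in> \<A>" using C(1) sub by (auto simp: \<A>_def)
  qed
  then obtain M where "M \<in> \<A>" and max: "\<And>G. G \<in> \<A> \<Longrightarrow> M \<subseteq> G \<Longrightarrow> G = M" by blast
  then have M: "G0 \<subseteq> M" "M \<subseteq> E' \<times> E"
    and M_contr: "\<And>y u y' u'. (y, u) \<in> M \<Longrightarrow> (y', u') \<in> M \<Longrightarrow> d u u' \<le> d' y y'"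
    by (auto simp: \<A>_def contr_def)
  have unique: "u = u'" if "(y, u) \<in> M" "(y, u') \<in> M" for y u u'
  proof -
    have "y \<in> E'" "u \<in> E" "u' \<in> E" using that M(2) by auto
    moreover from this have "d u u' \<le> 1" using M_contr[OF that] metric_self[OF E'] by simp
    ultimately show ?thesis using metric_eq[OF E] le_one_iff by blast
  qed
  have total: "\<exists>c. (z, c) \<in> M" if z: "z \<in> E'" for z
  proof -
    \<comment> \<open>\<open>p e\<close> is the infimum of the lengths of routes from
      \<open>z\<close> to \<open>e\<close> that cross from \<open>E'\<close> to \<open>E\<close> at
      a pair of \<open>M\<close>.\<close>
    define p where "p e = (INF m\<in>M. d' z (fst m) * d (snd m) e)" for e
    have inv_p: "invol (p e) = (INF m\<in>M. d e (snd m) * d' (fst m) z)" if "e \<in> E" for e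
      unfolding p_def invol_INF
    proof (rule INF_cong[OF refl])
      fix m assume "m \<in> M"
      then have "fst m \<in> E'" "snd m \<in> E" using M(2) by auto
      then show "invol (d' z (fst m) * d (snd m) e) = d e (snd m) * d' (fst m) z"
        using z that by (simp add: invol_mult metric_invol[OF E] metric_invol[OF E'])
    qed
    have "distance_form E d p"
      unfolding distance_form_def
    proof (intro ballI conjI)
      fix x y assume xy: "x \<in> E" "y \<in> E"
      show "p y \<le> p x * d x y"
        unfolding p_def INF_mult_right
      proof (rule INF_mono)
        fix m assume m: "m \<in> M"
        then have "snd m \<in> E" using M(2) by auto
        then have "d' z (fst m) * d (snd m) y \<le> d' z (fst m) * (d (snd m) x * d x y)"
          using xy by (intro heyting_mult_mono order.refl metric_triangle[OF E])
        then show "\<exists>n\<in>M. d' z (fst n) * d (snd n) y \<le> d' z (fst m) * d (snd m) x * d x y"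
          using m by (auto simp: mult.assoc)
      qed
      \<comment> \<open>Go from \<open>x\<close> to \<open>y\<close> through the values of
        \<open>m\<close> and \<open>n\<close>. Contractivity of \<open>M\<close> bounds the middle
        leg by a distance in \<open>E'\<close>, which is then split at \<open>z\<close>.\<close>
      have "d x y \<le> d x (snd m) * d' (fst m) z * (d' z (fst n) * d (snd n) y)"
        if "m \<in> M" "n \<in> M" for m n
      proof -
        have mn: "fst m \<in> E'" "snd m \<in> E" "fst n \<in> E'" "snd n \<in> E" using that M(2) by auto
        have "d x y \<le> d x (snd m) * d (snd m) y" using metric_triangle[OF E] mn xy by blast
        also have "\<dots> \<le> d x (snd m) * (d (snd m) (snd n) * d (snd n) y)"
          using mn xy by (intro heyting_mult_mono order.refl metric_triangle[OF E])
        also have "\<dots> \<le> d x (snd m) * (d' (fst m) (fst n) * d (snd n) y)"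
          using that M_contr[of "fst m" "snd m" "fst n" "snd n"]
          by (intro heyting_mult_mono order.refl) simp
        also have "\<dots> \<le> d x (snd m) * (d' (fst m) z * d' z (fst n) * d (snd n) y)"
          using mn z by (intro heyting_mult_mono order.refl metric_triangle[OF E'])
        finally show ?thesis by (simp add: mult.assoc)
      qed
      then show "d x y \<le> invol (p x) * p y"
        unfolding inv_p[OF xy(1)] unfolding p_def INF_mult_right INF_mult_left
        by (intro INF_greatest)
    qed
    then obtain c where c: "c \<in> E" "\<And>x. x \<in> E \<Longrightarrow> d c x \<le> p x"
      using dom unfolding forms_dominate_def by blast
    \<comment> \<open>In the infimum defining \<open>p u\<close>, the pair \<open>(y, u)\<close>
      itself contributes \<open>d' z y * d u u\<close>, which is \<open>d' z y\<close>.\<close>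
    have near: "d c u \<le> d' z y" if "(y, u) \<in> M" for y u
    proof -
      have "u \<in> E" using that M(2) by auto
      then have "d c u \<le> p u" by (rule c(2))
      also have "\<dots> \<le> d' z y * d u u" unfolding p_def by (rule INF_lower2[OF that]) simp
      finally show ?thesis using metric_self[OF E \<open>u \<in> E\<close>] by simp
    qed
    have near': "d u c \<le> d' y z" if "(y, u) \<in> M" for y u
    proof -
      have "u \<in> E" "y \<in> E'" using that M(2) by auto
      then show ?thesis
        using near[OF that] c(1) z by (metis invol_le_iff metric_invol[OF E] metric_invol[OF E'])
    qed
    have "contr (insert (z, c) M)"
      using near near' M_contr metric_self[OF E c(1)] by (auto simp: contr_def one_least)
    then have "insert (z, c) M \<in> \<A>" using M c(1) z by (auto simp: \<A>_def)
    then show ?thesis using max by blast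
  qed
  define h' where "h' y = (SOME u. (y, u) \<in> M)" for y
  have h': "(y, h' y) \<in> M" if "y \<in> E'" for y
    unfolding h'_def using total[OF that] by (rule someI_ex)
  show thesis
  proof
    show "nonexpansive E' d' E d h'"
      unfolding nonexpansive_def
    proof (intro conjI ballI)
      show "h' \<in> E' \<rightarrow> E" using h' M(2) by blast
      show "d (h' x) (h' y) \<le> d' x y" if "x \<in> E'" "y \<in> E'" for x y
        using M_contr h' that by blast
    qed
    fix y assume "y \<in> Y"
    then have "(y, h y) \<in> M" "(y, h' y) \<in> M" using h' Y M(1) by (auto simp: G0_def)
    then show "h' y = h y" using unique by blast
  qed
qed

section \<open>Injective spaces\<close>

lemma injective_space_extend:
  fixes E' E'' :: "'u set"
  assumes "injective_space TYPE('u) E d" "metric_over E' d'" "metric_over E'' d''"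
    and "nonexpansive E' d' E d f" "isometry E' d' E'' d'' g"
  obtains h where "nonexpansive E'' d'' E d h" "\<And>x. x \<in> E' \<Longrightarrow> h (g x) = f x"
  using assms unfolding injective_space_def by meson

text \<open>As \<open>E\<close> need not have type \<open>'u set\<close>, its copy in
  \<open>A\<close> takes its place, and the map to be extended to \<open>A\<close> is the inverse of
  the embedding.\<close>

lemma injective_forms_dominate:
  fixes E :: "'a set" and d :: "'a \<Rightarrow> 'a \<Rightarrow> 'h::heyting_monoid" and \<iota> :: "'a option \<Rightarrow> 'u"
  assumes inj: "inj \<iota>" and E: "injective_space TYPE('u) E d"
  shows "forms_dominate E d"
proof (rule forms_dominateI[OF _ inj])
  show metric: "metric_over E d" using E by (simp add: injective_space_def)
  fix A D assume A: "metric_over A D" and i: "isometry E d A D (\<iota> \<circ> Some)"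
  let ?S = "(\<iota> \<circ> Some) ` E"
  have sub: "?S \<subseteq> A" using i by (auto simp: isometry_def)
  have S: "metric_over ?S D" by (rule metric_over_subset[OF A sub])
  have "isomorphism E d ?S D (\<iota> \<circ> Some)" using i by (auto simp: isomorphism_def isometry_def)
  then have "isomorphism ?S D E d (inv_into E (\<iota> \<circ> Some))"
    by (rule isomorphism_inv[OF metric S])
  then have "nonexpansive ?S D E d (inv_into E (\<iota> \<circ> Some))"
    by (simp add: isomorphism_def isometry_nonexpansive)
  moreover have "isometry ?S D A D (\<lambda>x. x)" using sub by (auto simp: isometry_def)
  ultimately obtain r where r: "nonexpansive A D E d r"
    "\<And>x. x \<in> ?S \<Longrightarrow> r x = inv_into E (\<iota> \<circ> Some) x"
    by (rule injective_space_extend[OF E S A]) blast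
  have "r (\<iota> (Some x)) = x" if "x \<in> E" for x
    using r(2)[of "\<iota> (Some x)"] inv_into_f_f[OF isometry_inj_on[OF metric A i] that] that
    by auto
  then show "\<exists>r. nonexpansive A D E d r \<and> (\<forall>x\<in>E. r (\<iota> (Some x)) = x)" using r(1) by blast
qed

text \<open>Since \<open>g\<close> is injective, \<open>f\<close> can be read as a map on the image
  of \<open>g\<close>, a subspace of \<open>E''\<close>, where the extension lemma applies.\<close>

lemma forms_dominate_injective:
  fixes E :: "'a set" and d :: "'a \<Rightarrow> 'a \<Rightarrow> 'h::heyting_monoid"
  assumes E: "metric_over E d" and dom: "forms_dominate E d"
  shows "injective_space TYPE('u) E d"
  unfolding injective_space_def
proof (intro conjI allI impI E, elim conjE)
  fix E' E'' :: "'u set" and d' d'' f g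
  assume E': "metric_over E' d'" and E'': "metric_over E'' d''"
    and f: "nonexpansive E' d' E d f" and g: "isometry E' d' E'' d'' g"
  have sub: "g ` E' \<subseteq> E''" using g by (auto simp: isometry_def)
  have "isomorphism E' d' (g ` E') d'' g" using g by (auto simp: isomorphism_def isometry_def)
  then have "isomorphism (g ` E') d'' E' d' (inv_into E' g)"
    by (rule isomorphism_inv[OF E' metric_over_subset[OF E'' sub]])
  then have "nonexpansive (g ` E') d'' E d (f \<circ> inv_into E' g)"
    using f by (auto simp: isomorphism_def intro: nonexpansive_comp isometry_nonexpansive)
  then obtain h where h: "nonexpansive E'' d'' E d h"
    "\<And>y. y \<in> g ` E' \<Longrightarrow> h y = (f \<circ> inv_into E' g) y"
    using forms_dominate_extend[OF E dom E'' sub] by blast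
  have "h (g x) = f x" if "x \<in> E'" for x
    using h(2)[of "g x"] that isometry_inj_on[OF E' E'' g] by simp
  then show "\<exists>h. nonexpansive E'' d'' E d h \<and> (\<forall>x\<in>E'. h (g x) = f x)" using h(1) by blast
qed

lemma injective_space_isomorphism:
  fixes N :: "'b set" and dN :: "'b \<Rightarrow> 'b \<Rightarrow> 'h::heyting_monoid"
  assumes E: "injective_space TYPE('u) E d" and N: "metric_over N dN"
    and \<phi>: "isomorphism E d N dN \<phi>"
  shows "injective_space TYPE('u) N dN"
  unfolding injective_space_def
proof (intro conjI allI impI N, elim conjE)
  fix E' E'' :: "'u set" and d' d'' f g
  assume *: "metric_over E' d'" "metric_over E'' d''" "isometry E' d' E'' d'' g"
    and f: "nonexpansive E' d' N dN f"
  have "metric_over E d" using E by (simp add: injective_space_def)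
  then have "isomorphism N dN E d (inv_into E \<phi>)" by (rule isomorphism_inv[OF _ N \<phi>])
  then have "nonexpansive E' d' E d (inv_into E \<phi> \<circ> f)"
    using f by (auto simp: isomorphism_def intro: nonexpansive_comp isometry_nonexpansive)
  then obtain h where h: "nonexpansive E'' d'' E d h" "\<And>x. x \<in> E' \<Longrightarrow> h (g x) = inv_into E \<phi> (f x)"
    using injective_space_extend[OF E *(1,2) _ *(3)] by (metis comp_apply)
  have "nonexpansive E'' d'' N dN (\<phi> \<circ> h)"
    using h(1) \<phi> by (auto simp: isomorphism_def intro: nonexpansive_comp isometry_nonexpansive)
  moreover have "(\<phi> \<circ> h) (g x) = f x" if "x \<in> E'" for x
  proof -
    have "f x \<in> \<phi> ` E" using f \<phi> that by (auto simp: nonexpansive_def isomorphism_def)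
    then show ?thesis using h(2)[OF that] by (simp add: f_inv_into_f)
  qed
  ultimately show "\<exists>h. nonexpansive E'' d'' N dN h \<and> (\<forall>x\<in>E'. h (g x) = f x)" by blast
qed

section \<open>Essential maps\<close>

text \<open>The image of a test map is no larger than its domain, so test spaces of every type are covered.\<close>

lemma essential_map_isometry:
  fixes N :: "'b set" and dN :: "'b \<Rightarrow> 'b \<Rightarrow> 'h::heyting_monoid" and i :: "'b \<Rightarrow> 'u"
    and E' :: "'c set"
  assumes ess: "essential_map TYPE('u) X d N dN j" and inj: "inj_on i N"
    and E': "metric_over E' d'" and k: "nonexpansive N dN E' d' k"
    and kj: "isometry X d E' d' (k \<circ> j)"
  shows "isometry N dN E' d' k"
proof -
  have j: "j \<in> X \<rightarrow> N" using ess by (simp add: essential_map_def nonexpansive_def)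
  \<comment> \<open>\<open>s\<close> picks one preimage in \<open>N\<close> for each point of the
    image and moves it to \<open>'u\<close>; it is injective there even if \<open>k\<close> is
    not.\<close>
  define s where "s = i \<circ> inv_into N k"
  have sub: "k ` N \<subseteq> E'" using k by (auto simp: nonexpansive_def)
  have "inj_on s (k ` N)"
    unfolding s_def
    by (intro comp_inj_on inj_on_inv_into order.refl inj_on_subset[OF inj])
      (auto intro: inv_into_into)
  then obtain D where D: "metric_over (s ` k ` N) D" "isometry (k ` N) d' (s ` k ` N) D s"
    using metric_transport[OF metric_over_subset[OF E' sub]] by (metis isomorphism_def)
  have D_eq: "D (s (k x)) (s (k y)) = d' (k x) (k y)" if "x \<in> N" "y \<in> N" for x y
    using D(2) that by (auto simp: isometry_def)
  have "nonexpansive N dN (s ` k ` N) D (s \<circ> k)"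
    using k D_eq by (auto simp: nonexpansive_def)
  moreover have "isometry X d (s ` k ` N) D ((s \<circ> k) \<circ> j)"
    using kj j D_eq by (auto simp: isometry_def Pi_iff)
  ultimately have "isometry N dN (s ` k ` N) D (s \<circ> k)"
    using ess D(1) unfolding essential_map_def by blast
  then show ?thesis using D_eq sub by (auto simp: isometry_def)
qed

text \<open>\<open>D\<close> measures the distance to the pair \<open>a\<close>, \<open>b\<close>,
  and \<open>\<rho>\<close> allows a detour through the glued point. On \<open>X\<close> the detour
  is no shortcut, so essentiality forces the gluing to be an isometry.\<close>

lemma essential_separates:
  fixes E X :: "'a set" and d :: "'a \<Rightarrow> 'a \<Rightarrow> 'h::heyting_monoid" and i :: "'a \<Rightarrow> 'u"
  assumes ess: "essential_map TYPE('u) X d E d id" and inj: "inj_on i E"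
    and E: "metric_over E d" and X: "X \<subseteq> E"
    and ab: "a \<in> E" "b \<in> E" and eq: "\<And>x. x \<in> X \<Longrightarrow> d x a = d x b"
  shows "a = b"
proof -
  text \<open>\<open>\<rho>\<close> is the distance after gluing \<open>a\<close> and \<open>b\<close>. It is only a pseudometric:
    other points may get identified too, as \<open>inf p q = 1\<close> does not imply \<open>p = 1 \<or> q = 1\<close>.\<close>
  define D where "D x = inf (d x a) (d x b)" for x
  define \<rho> where "\<rho> x y = inf (d x y) (D x * invol (D y))" for x y
  have D_tri: "D x \<le> d x y * D y" if "x \<in> E" "y \<in> E" for x y
    unfolding D_def inf_mult_left
    using metric_triangle[OF E that(1) _ that(2)] ab by (blast intro: inf_mono)
  have D_tri': "invol (D y) \<le> invol (D x) * d x y" if "x \<in> E" "y \<in> E" for x y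
    using invol_mono[OF D_tri[OF that(2,1)]] metric_invol[OF E that(2,1)] by (simp add: invol_mult)
  obtain q where q: "q \<in> E \<rightarrow> E" "metric_over (q ` E) \<rho>"
    "\<And>x y. x \<in> E \<Longrightarrow> y \<in> E \<Longrightarrow> \<rho> (q x) (q y) = \<rho> x y"
  proof (rule pseudometric_quotient[of E \<rho>])
    fix x y assume x: "x \<in> E"
    show "\<rho> x x = 1" unfolding \<rho>_def metric_self[OF E x] by (simp add: inf_absorb1 one_least)
    assume y: "y \<in> E"
    show "\<rho> x y = invol (\<rho> y x)"
      using metric_invol[OF E y x] by (simp add: \<rho>_def invol_inf invol_mult invol_invol)
    fix z assume z: "z \<in> E"
    \<comment> \<open>Distributivity splits \<open>\<rho> x z * \<rho> z y\<close> into a meet of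
      four products, according to which of the two legs take the detour; each product is bounded
      separately.\<close>
    have "\<rho> x y \<le> d x z * d z y"
      unfolding \<rho>_def using metric_triangle[OF E x y z] by (rule le_infI1)
    moreover have "\<rho> x y \<le> d x z * (D z * invol (D y))"
      unfolding \<rho>_def mult.assoc[symmetric]
      by (intro le_infI2 heyting_mult_mono D_tri x z order.refl)
    moreover have "\<rho> x y \<le> D x * invol (D z) * d z y"
      unfolding \<rho>_def mult.assoc
      by (intro le_infI2 heyting_mult_mono D_tri' y z order.refl)
    moreover have "\<rho> x y \<le> D x * invol (D z) * (D z * invol (D y))"
      unfolding \<rho>_def by (intro le_infI2 heyting_mult_mono le_mult_left le_mult_right)
    ultimately show "\<rho> x y \<le> \<rho> x z * \<rho> z y"
      unfolding \<rho>_def[of x z] \<rho>_def[of z y] inf_mult_left inf_mult_right by simp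
  qed blast
  have "\<rho> x y = d x y" if "x \<in> X" "y \<in> X" for x y
  proof -
    have xy: "x \<in> E" "y \<in> E" using that X by auto
    \<comment> \<open>For points of \<open>X\<close> the two distances in \<open>D\<close> agree, so
      the detour costs as much as the path through \<open>a\<close>.\<close>
    have "d x y \<le> d x a * d a y" by (rule metric_triangle[OF E xy ab(1)])
    also have "\<dots> = D x * invol (D y)"
      using eq that metric_invol[OF E xy(2) ab(1)] by (simp add: D_def)
    finally show ?thesis unfolding \<rho>_def by (rule inf_absorb1)
  qed
  then have "isometry X d (q ` E) \<rho> (q \<circ> id)"
    using q(3) X by (auto simp: isometry_def subset_iff)
  moreover have "nonexpansive E d (q ` E) \<rho> q"
    using q(3) by (auto simp: nonexpansive_def \<rho>_def)
  ultimately have "isometry E d (q ` E) \<rho> q"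
    using essential_map_isometry[OF ess inj q(2)] by blast
  \<comment> \<open>The detour between \<open>a\<close> and \<open>b\<close> has length 1, so
    preserving their distance means that they coincide.\<close>
  then have "d a b = \<rho> a b" using q(3) ab by (simp add: isometry_def)
  also have "\<rho> a b \<le> D a * invol (D b)" by (simp add: \<rho>_def)
  also have "\<dots> \<le> d a a * invol (d b b)"
    unfolding D_def by (intro heyting_mult_mono invol_mono) simp_all
  finally have "d a b = 1" using metric_self[OF E] ab by (simp add: le_one_iff)
  then show ?thesis using metric_eq[OF E] ab by blast
qed

text \<open>Essentiality makes \<open>h\<close> an isometry; as it fixes \<open>X\<close>, the
  points \<open>h e\<close> and \<open>e\<close> have equal distances from \<open>X\<close>.\<close>

lemma essential_rigid:
  fixes E X :: "'a set" and d :: "'a \<Rightarrow> 'a \<Rightarrow> 'h::heyting_monoid" and i :: "'a \<Rightarrow> 'u"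
  assumes ess: "essential_map TYPE('u) X d E d id" and inj: "inj_on i E"
    and E: "metric_over E d" and X: "X \<subseteq> E"
    and h: "nonexpansive E d E d h" "\<And>x. x \<in> X \<Longrightarrow> h x = x" and e: "e \<in> E"
  shows "h e = e"
proof (rule essential_separates[OF ess inj E X _ e])
  have "isometry X d E d (h \<circ> id)" using h(2) X by (auto simp: isometry_def)
  then have iso: "isometry E d E d h" by (rule essential_map_isometry[OF ess inj E h(1)])
  then show "h e \<in> E" using e by (auto simp: isometry_def)
  fix x assume "x \<in> X"
  then show "d x (h e) = d x e" using iso h(2) e X by (metis isometry_def subsetD)
qed

section \<open>The characterization\<close>

text \<open>The envelope lives in \<open>'u\<close> and the test spaces of the condition in
  \<open>'v\<close>. The injections \<open>\<iota>\<close> and \<open>\<kappa>\<close> make room in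
  both for one-point extensions of \<open>E\<close>, and the two universes are otherwise
  unrelated.\<close>

theorem theorem4:
  fixes E X :: "'a set" and d :: "'a \<Rightarrow> 'a \<Rightarrow> 'h::heyting_monoid"
    and \<iota> :: "'a option \<Rightarrow> 'u" and \<kappa> :: "'a option \<Rightarrow> 'v"
  assumes "inj \<iota>" and "inj \<kappa>"
    and "metric_over E d" and "X \<subseteq> E"
  shows "is_envelope_of_subspace TYPE('u) E d X \<longleftrightarrow>
    (\<forall>(E' :: 'v set) d' X' f.
       metric_over E' d' \<and> X' \<subseteq> E' \<and> isomorphism X d X' d' f \<longrightarrow>
         (\<forall>f'. nonexpansive E d E' d' f' \<and> (\<forall>x\<in>X. f' x = f x) \<longrightarrow> isometry E d E' d' f') \<and>
         (\<exists>h. nonexpansive E' d' E d h \<and> (\<forall>y\<in>X'. h y = inv_into X f y)))"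
    (is "?env \<longleftrightarrow> ?cond")
proof
  note E = \<open>metric_over E d\<close> and X = \<open>X \<subseteq> E\<close>
  note mX = metric_over_subset[OF E X]
  {
    assume ?env
    then obtain N :: "'u set" and dN j \<phi> where
      N: "injective_space TYPE('u) N dN" and ess: "essential_map TYPE('u) X d N dN j"
      and \<phi>: "isomorphism E d N dN \<phi>" and \<phi>j: "\<And>x. x \<in> X \<Longrightarrow> \<phi> x = j x"
      unfolding is_envelope_of_subspace_def injective_envelope_def by blast
    have mN: "metric_over N dN" using N by (simp add: injective_space_def)
    \<comment> \<open>Injectivity and essentiality are known for \<open>N\<close>, so maps on
      \<open>E\<close> are carried to \<open>N\<close> along \<open>\<psi>\<close>.\<close>
    define \<psi> where "\<psi> = inv_into E \<phi>"
    have \<psi>: "isomorphism N dN E d \<psi>" unfolding \<psi>_def by (rule isomorphism_inv[OF E mN \<phi>])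
    have \<psi>\<phi>: "\<psi> (\<phi> x) = x" if "x \<in> E" for x
      using isometry_inj_on[OF E mN] \<phi> that by (simp add: \<psi>_def isomorphism_def)
    \<comment> \<open>Domination of forms does not mention \<open>'u\<close>, so it can be used for
      test spaces in \<open>'v\<close>.\<close>
    have dom: "forms_dominate E d"
      by (rule injective_forms_dominate[OF \<open>inj \<iota>\<close> injective_space_isomorphism[OF N E \<psi>]])
    show ?cond
    proof (intro allI impI conjI; (elim conjE)?)
      fix E' :: "'v set" and d' X' f f'
      assume E': "metric_over E' d'" and f: "isomorphism X d X' d' f" "X' \<subseteq> E'"
        and f': "nonexpansive E d E' d' f'" "\<forall>x\<in>X. f' x = f x"
      have k: "nonexpansive N dN E' d' (f' \<circ> \<psi>)"
        using \<psi> f'(1) by (auto simp: isomorphism_def intro: nonexpansive_comp isometry_nonexpansive)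
      have "(f' \<circ> \<psi> \<circ> j) x = f x" if "x \<in> X" for x
        using that X f'(2) by (simp add: \<psi>\<phi> subsetD flip: \<phi>j)
      then have "isometry X d E' d' (f' \<circ> \<psi> \<circ> j)"
        using f by (auto simp: isomorphism_def isometry_def)
      then have "isometry N dN E' d' (f' \<circ> \<psi>)"
        by (rule essential_map_isometry[OF ess inj_on_id E' k])
      then have "isometry E d E' d' (f' \<circ> \<psi> \<circ> \<phi>)"
        using \<phi> by (auto simp: isomorphism_def intro: isometry_comp)
      then show "isometry E d E' d' f'"
        using f'(1) by (auto simp: isometry_def nonexpansive_def \<psi>\<phi>)
    next
      fix E' :: "'v set" and d' X' f
      assume E': "metric_over E' d'" and X': "X' \<subseteq> E'" and f: "isomorphism X d X' d' f"
      \<comment> \<open>For (ii), the inverse of \<open>f\<close> followed by the inclusion of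
        \<open>X\<close> into \<open>E\<close> is a non-expansive map on \<open>X'\<close>, ready to
        be extended to \<open>E'\<close>.\<close>
      have "isomorphism X' d' X d (inv_into X f)"
        by (rule isomorphism_inv[OF mX metric_over_subset[OF E' X'] f])
      then have "nonexpansive X' d' E d (inv_into X f)"
        using X by (auto simp: isomorphism_def isometry_def nonexpansive_def)
      then show "\<exists>h. nonexpansive E' d' E d h \<and> (\<forall>y\<in>X'. h y = inv_into X f y)"
        using forms_dominate_extend[OF E dom E' X'] by metis
    qed
  }
  {
    assume ?cond
    have extension: "isometry E d E' d' f'"
      if "metric_over E' d'" "X' \<subseteq> E'" "isomorphism X d X' d' f"
        "nonexpansive E d E' d' f'" "\<And>x. x \<in> X \<Longrightarrow> f' x = f x"
      for E' :: "'v set" and d' X' f f'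
      using \<open>?cond\<close> that by simp
    have retraction: "\<exists>h. nonexpansive E' d' E d h \<and> (\<forall>y\<in>X'. h y = inv_into X f y)"
      if "metric_over E' d'" "X' \<subseteq> E'" "isomorphism X d X' d' f"
      for E' :: "'v set" and d' X' f
      using \<open>?cond\<close> that by simp
    have ess: "essential_map TYPE('v) X d E d id"
      unfolding essential_map_def
    proof (intro conjI allI impI; (elim conjE)?)
      show "nonexpansive X d E d id" using X by (auto simp: nonexpansive_def)
      fix E'' :: "'v set" and d'' g
      assume E'': "metric_over E'' d''" and g: "nonexpansive E d E'' d'' g"
      show "isometry X d E'' d'' (g \<circ> id) \<longleftrightarrow> isometry E d E'' d'' g"
      proof
        assume "isometry X d E'' d'' (g \<circ> id)"
        \<comment> \<open>Here (i) is applied with the image of \<open>X\<close> under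
          \<open>g\<close> as \<open>X'\<close>, and with \<open>g\<close> both as the isometry and
          as its extension.\<close>
        then have "isomorphism X d (g ` X) d'' g" "g ` X \<subseteq> E''"
          by (auto simp: isomorphism_def isometry_def)
        then show "isometry E d E'' d'' g" using extension[OF E''] g by blast
      next
        assume "isometry E d E'' d'' g"
        then show "isometry X d E'' d'' (g \<circ> id)" using X by (auto simp: isometry_def)
      qed
    qed
    have inj_\<kappa>: "inj_on (\<kappa> \<circ> Some) E"
      using inj_compose[OF \<open>inj \<kappa>\<close> inj_Some] by (rule inj_on_subset) simp
    have dom: "forms_dominate E d"
    proof (rule forms_dominateI[OF E \<open>inj \<kappa>\<close>])
      fix A D assume A: "metric_over A D" and i: "isometry E d A D (\<kappa> \<circ> Some)"
      let ?f = "\<kappa> \<circ> Some"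
      have "isomorphism X d (?f ` X) D ?f" "?f ` X \<subseteq> A"
        using i X by (auto simp: isomorphism_def isometry_def)
      then have "\<exists>h. nonexpansive A D E d h \<and> (\<forall>y\<in>?f ` X. h y = inv_into X ?f y)"
        using retraction[OF A] by blast
      then obtain h where h: "nonexpansive A D E d h" "\<And>y. y \<in> ?f ` X \<Longrightarrow> h y = inv_into X ?f y"
        by blast
      \<comment> \<open>Condition (ii) controls \<open>h\<close> only on the copy of
        \<open>X\<close>. Composed with the embedding, \<open>h\<close> becomes a self-map of
        \<open>E\<close> fixing \<open>X\<close>, and rigidity makes it the identity.\<close>
      have "nonexpansive E d E d (h \<circ> ?f)"
        by (rule nonexpansive_comp[OF isometry_nonexpansive[OF i] h(1)])
      moreover have "(h \<circ> ?f) x = x" if "x \<in> X" for x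
        using h(2)[of "?f x"] inv_into_f_f[OF inj_on_subset[OF inj_\<kappa> X] that] that by simp
      ultimately have "(h \<circ> ?f) e = e" if "e \<in> E" for e
        using essential_rigid[OF ess inj_\<kappa> E X] that by blast
      then show "\<exists>r. nonexpansive A D E d r \<and> (\<forall>x\<in>E. r (\<kappa> (Some x)) = x)" using h(1) by auto
    qed
    \<comment> \<open>The envelope must be a \<open>'u set\<close>, so a copy of \<open>E\<close> is
      used; its essential map is the restriction of \<open>\<phi>\<close>, so agreement on
      \<open>X\<close> is immediate.\<close>
    define \<phi> where "\<phi> = \<iota> \<circ> Some"
    have "inj_on \<phi> E"
      unfolding \<phi>_def using inj_compose[OF \<open>inj \<iota>\<close> inj_Some] by (rule inj_on_subset) simp
    then obtain dN where N: "metric_over (\<phi> ` E) dN" and \<phi>: "isomorphism E d (\<phi> ` E) dN \<phi>"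
      using metric_transport[OF E] by blast
    have "injective_space TYPE('u) (\<phi> ` E) dN"
      by (rule injective_space_isomorphism[OF forms_dominate_injective[OF E dom] N \<phi>])
    moreover have "essential_map TYPE('u) X d (\<phi> ` E) dN \<phi>"
      unfolding essential_map_def
    proof (intro conjI allI impI; (elim conjE)?)
      show "nonexpansive X d (\<phi> ` E) dN \<phi>"
        using \<phi> X by (auto simp: nonexpansive_def isomorphism_def isometry_def subset_iff)
      fix E'' :: "'u set" and d'' g
      assume E'': "metric_over E'' d''" and g: "nonexpansive (\<phi> ` E) dN E'' d'' g"
      have g\<phi>: "nonexpansive E d E'' d'' (g \<circ> \<phi>)"
        using \<phi> g by (auto simp: isomorphism_def intro: nonexpansive_comp isometry_nonexpansive)
      show "isometry X d E'' d'' (g \<circ> \<phi>) \<longleftrightarrow> isometry (\<phi> ` E) dN E'' d'' g"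
      proof
        assume "isometry X d E'' d'' (g \<circ> \<phi>)"
        \<comment> \<open>Essentiality was obtained with test spaces in \<open>'v\<close>; it
          applies to \<open>E''\<close> in \<open>'u\<close> because
          \<open>\<kappa> \<circ> Some\<close> embeds \<open>E\<close> in \<open>'v\<close>.\<close>
        then have "isometry E d E'' d'' (g \<circ> \<phi>)"
          using essential_map_isometry[OF ess inj_\<kappa> E'' g\<phi>] by simp
        then show "isometry (\<phi> ` E) dN E'' d'' g"
          using \<phi> by (auto simp: isomorphism_def isometry_def)
      next
        assume "isometry (\<phi> ` E) dN E'' d'' g"
        then show "isometry X d E'' d'' (g \<circ> \<phi>)"
          using \<phi> X by (auto simp: isomorphism_def isometry_def subset_iff)
      qed
    qed
    ultimately show ?env
      unfolding is_envelope_of_subspace_def injective_envelope_def using \<phi> by blast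
  }
qed

end
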